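(* Let $\Gamma$ be a Polish group acting continuously on a Polish space $X$ and let $E$ be the associated orbit equivalence relation. If $E$ has the Borel coding property, then $E$ is Borel graphable by a Borel graph of diameter $4$.
   Context: An analytic equivalence relation $E$ on $X$ has the Borel coding property if there is a Borel function $f\colon X\to 2^{\mathbb{N}}$ such that for all $x\in X$ and $a\in 2^{\mathbb{N}}$ there is $y$ with $x\,E\,y$ such that $f(y)$ Turing-computes $a$. $E$ is Borel graphable by $G$ if $G$ is a Borel graph on $X$ whose connectedness relation equals $E$; the diameter of a graph is the maximum distance between two connected vertices. *)

theory Defs
  imports "HOL-Analysis.Analysis" "HOL-Library.Extended_Nat"
begin

section \<open>Turing reducibility\<close>

text \<open>
  Oracle machines have a two-way infinite work tape (symbol 0 is the blank) and a read-only
  oracle tape. On the oracle tape, cell \<open>i \<ge> 0\<close> carries the \<open>i\<close>-th bit of the oracle and negative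
  cells are empty. The program is a finite table; the machine halts when no entry applies.
\<close>

datatype move = Left | Stay | Right

type_synonym oracle_program =
  "nat \<times> nat \<times> bool option \<rightharpoonup> nat \<times> nat \<times> move \<times> move"

record oracle_config =
  state :: nat
  work_tape :: "int \<Rightarrow> nat"
  work_head :: int
  oracle_head :: int

fun shift :: "move \<Rightarrow> int \<Rightarrow> int" where
  "shift Left i = i - 1"
| "shift Stay i = i"
| "shift Right i = i + 1"

definition oracle_tape :: "(nat \<Rightarrow> bool) \<Rightarrow> int \<Rightarrow> bool option" where
  "oracle_tape b i = (if i < 0 then None else Some (b (nat i)))"

definition scanned :: "(nat \<Rightarrow> bool) \<Rightarrow> oracle_config \<Rightarrow> nat \<times> nat \<times> bool option" where
  "scanned b c = (state c, work_tape c (work_head c), oracle_tape b (oracle_head c))"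

definition halted :: "oracle_program \<Rightarrow> (nat \<Rightarrow> bool) \<Rightarrow> oracle_config \<Rightarrow> bool" where
  "halted p b c \<longleftrightarrow> p (scanned b c) = None"

definition step :: "oracle_program \<Rightarrow> (nat \<Rightarrow> bool) \<Rightarrow> oracle_config \<Rightarrow> oracle_config" where
  "step p b c = (case p (scanned b c) of
      None \<Rightarrow> c
    | Some (q, s, d, d') \<Rightarrow>
        \<lparr>state = q,
         work_tape = (work_tape c)(work_head c := s),
         work_head = shift d (work_head c),
         oracle_head = shift d' (oracle_head c)\<rparr>)"

text \<open>The input \<open>n\<close> is written in unary, as \<open>n\<close> consecutive symbols 1 starting at cell 0.\<close>

definition initial_config :: "nat \<Rightarrow> oracle_config" where
  "initial_config n =
    \<lparr>state = 0,
     work_tape = (\<lambda>i. if 0 \<le> i \<and> i < int n then 1 else 0),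
     work_head = 0,
     oracle_head = 0\<rparr>"

text \<open>\<open>turing_computes b a\<close>: some machine with oracle \<open>b\<close> halts on every input \<open>n\<close>, scanning on its
  work tape the symbol 1 if the \<open>n\<close>-th bit of \<open>a\<close> is 1 and the blank 0 otherwise.\<close>

definition turing_computes :: "(nat \<Rightarrow> bool) \<Rightarrow> (nat \<Rightarrow> bool) \<Rightarrow> bool" where
  "turing_computes b a \<longleftrightarrow>
    (\<exists>p :: oracle_program. finite (dom p) \<and>
      (\<forall>n. \<exists>k. let c = (step p b ^^ k) (initial_config n) in
         halted p b c \<and> work_tape c (work_head c) = (if a n then 1 else 0)))"

section \<open>Continuous actions and their orbit equivalence relations\<close>

text \<open>Groups are written additively, as \<^class>\<open>topological_group_add\<close> is the library's class of
  topological groups; commutativity is not assumed.\<close>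

definition continuous_action ::
  "('g::topological_group_add \<Rightarrow> 'x::topological_space \<Rightarrow> 'x) \<Rightarrow> bool" where
  "continuous_action act \<longleftrightarrow>
    (\<forall>x. act 0 x = x) \<and>
    (\<forall>g h x. act (g + h) x = act g (act h x)) \<and>
    continuous_on UNIV (\<lambda>(g, x). act g x)"

definition orbit_equivalence :: "('g \<Rightarrow> 'x \<Rightarrow> 'x) \<Rightarrow> ('x \<times> 'x) set" where
  "orbit_equivalence act = {(x, y). \<exists>g. act g x = y}"

section \<open>Borel coding property\<close>

text \<open>The notion is meant for analytic equivalence relations. Orbit equivalence relations of
  continuous actions of Polish groups on Polish spaces are always analytic, so this is not made
  part of the definition.\<close>

definition borel_coding_property :: "('x::topological_space \<times> 'x) set \<Rightarrow> bool" where
  "borel_coding_property E \<longleftrightarrow>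
    (\<exists>f :: 'x \<Rightarrow> nat \<Rightarrow> bool. f \<in> borel_measurable borel \<and>
      (\<forall>x a. \<exists>y. (x, y) \<in> E \<and> turing_computes (f y) a))"

section \<open>Borel graphs\<close>

definition borel_graph :: "('x::topological_space \<times> 'x) set \<Rightarrow> bool" where
  "borel_graph G \<longleftrightarrow> sym G \<and> irrefl G \<and> G \<in> sets borel"

definition borel_graphable_by ::
  "('x::topological_space \<times> 'x) set \<Rightarrow> ('x \<times> 'x) set \<Rightarrow> bool" where
  "borel_graphable_by E G \<longleftrightarrow> borel_graph G \<and> G\<^sup>* = E"

definition graph_distance :: "('x \<times> 'x) set \<Rightarrow> 'x \<Rightarrow> 'x \<Rightarrow> nat" where
  "graph_distance G x y = (LEAST n. (x, y) \<in> G ^^ n)"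

definition graph_diameter :: "('x \<times> 'x) set \<Rightarrow> enat" where
  "graph_diameter G = (SUP (x, y) \<in> G\<^sup>*. enat (graph_distance G x y))"

end

theory Submission
  imports Defs
begin

text \<open>
  Orbits are uncountable, because each real computes only countably many reals; hence no stabilizer
  is open. Thus from a point \<open>x\<close> one can choose, in a Borel way, group elements \<open>d\<^sub>0, d\<^sub>1, \<dots>\<close> tending
  to \<open>0\<close> so fast that, for every bit sequence \<open>a\<close>, the sum of the \<open>d\<^sub>n\<close> with \<open>a n\<close> converges, and the
  translate \<open>U x a\<close> of \<open>x\<close> by this sum determines \<open>a\<close> through a Borel function of \<open>x\<close> and \<open>U x a\<close>.

  Join \<open>x\<close> to every point \<open>U x a\<close>. Moreover, join \<open>u\<close> to \<open>v\<close> whenever the code of \<open>v\<close> computes a point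
  \<open>x\<close> such that \<open>u = U x a\<close> for a sequence \<open>a\<close> coding a group element that moves \<open>x\<close> to \<open>v\<close>. Both
  conditions are Borel and both imply orbit equivalence. If \<open>x\<close> and \<open>y\<close> lie in one orbit, choose \<open>v\<close> in
  this orbit whose code computes both \<open>x\<close> and \<open>y\<close>. The group elements moving \<open>x\<close> and \<open>y\<close> to \<open>v\<close> need not
  be computable from \<open>v\<close>; they are stored in intermediate points \<open>u = U x a\<close> and \<open>u' = U y b\<close>, which
  gives the path \<open>x, u, v, u', y\<close>.

  This graph has diameter at most 4. To reach 4 exactly, repeatedly identify a vertex with a fixed one
  and reattach it as a pendant vertex, so that an ever longer tail grows in one orbit. Each such step
  raises the diameter by at most 1, so the value 4 is not skipped.
\<close>

section \<open>Countably many Borel decodings\<close>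

text \<open>A halted configuration is a fixed point of \<open>step\<close>, so all halting stages
  show the same result and the output does not depend on the witness \<open>k\<close>.\<close>

lemma halted_unique:
  assumes "halted p b ((step p b ^^ j) c)" "halted p b ((step p b ^^ k) c)"
  shows "(step p b ^^ j) c = (step p b ^^ k) c"
proof -
  have stay: "(step p b ^^ i) c' = c'" if "halted p b c'" for i c'
    using that by (induction i) (auto simp: step_def halted_def)
  have "(step p b ^^ m) c = (step p b ^^ n) c"
    if "n \<le> m" "halted p b ((step p b ^^ n) c)" for m n
  proof -
    have "(step p b ^^ m) c = (step p b ^^ (m - n)) ((step p b ^^ n) c)"
      using that(1) by (metis funpow_add le_add_diff_inverse2 o_apply)
    then show ?thesis using stay[OF that(2)] by simp
  qed
  then show ?thesis using assms by (metis linear)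
qed

text \<open>Divergence, or any final symbol other than 1, counts as the bit 0. Thus every program
  gives a total map on oracles.\<close>

definition computed :: "oracle_program \<Rightarrow> (nat \<Rightarrow> bool) \<Rightarrow> nat \<Rightarrow> bool" where
  "computed p b n \<longleftrightarrow> (\<exists>k. let c = (step p b ^^ k) (initial_config n) in
     halted p b c \<and> work_tape c (work_head c) = 1)"

lemma turing_computes_imp_computed:
  assumes "turing_computes b a"
  obtains p where "finite (dom p)" "computed p b = a"
proof -
  obtain p where p: "finite (dom p)"
    "\<And>n. \<exists>k. let c = (step p b ^^ k) (initial_config n) in
         halted p b c \<and> work_tape c (work_head c) = (if a n then 1 else 0)"
    using assms unfolding turing_computes_def by blast
  have "computed p b n = a n" for n
  proof -
    obtain k where k: "halted p b ((step p b ^^ k) (initial_config n))"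
      "work_tape ((step p b ^^ k) (initial_config n)) (work_head ((step p b ^^ k) (initial_config n)))
        = (if a n then 1 else 0)"
      using p(2)[of n] by (auto simp: Let_def)
    show ?thesis
      unfolding computed_def Let_def
      using k halted_unique[OF k(1)] by (metis zero_neq_one)
  qed
  then show ?thesis using that p(1) by blast
qed

instance move :: countable
  by countable_datatype

lemma countable_programs: "countable {p :: oracle_program. finite (dom p)}"
proof -
  have "p \<in> range map_of" if "finite (dom p)" for p :: oracle_program
  proof -
    obtain xs where "set xs = dom p" using finite_list[OF \<open>finite (dom p)\<close>] by blast
    then show ?thesis using map_of_map_keys by (metis rangeI)
  qed
  then have "{p :: oracle_program. finite (dom p)} \<subseteq> range map_of" by blast
  then show ?thesis by (rule countable_subset) simp
qed

lemma countable_turing_computes: "countable {a. turing_computes b a}"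
proof (rule countable_subset)
  show "{a. turing_computes b a} \<subseteq> (\<lambda>p. computed p b) ` {p. finite (dom p)}"
    using turing_computes_imp_computed by blast
qed (simp add: countable_programs)

text \<open>Configurations form an uncountable type, so the induction peels off the first step, not
  the last. From the fixed configuration \<open>c\<close> this step reads at most one oracle bit and
  leads to one of three configurations that do not depend on \<open>x\<close>; the induction
  hypothesis applies to each.\<close>

lemma pred_iterate_step:
  assumes b: "\<And>n. Measurable.pred M (\<lambda>x. b x n)"
    and Q: "\<And>c. Measurable.pred M (\<lambda>x. Q x c)"
  shows "Measurable.pred M (\<lambda>x. Q x ((step p (b x) ^^ k) c))"
proof (induction k arbitrary: c)
  case (Suc k)
  define i where "i = oracle_head c"
  define next_config where "next_config o' = (case p (state c, work_tape c (work_head c), o') of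
      None \<Rightarrow> c
    | Some (q, s, d, d') \<Rightarrow>
        \<lparr>state = q, work_tape = (work_tape c)(work_head c := s),
         work_head = shift d (work_head c), oracle_head = shift d' (oracle_head c)\<rparr>)" for o'
  have "step p b' c = (if i < 0 then next_config None else
      if b' (nat i) then next_config (Some True) else next_config (Some False))" for b'
    by (auto simp: step_def scanned_def next_config_def i_def oracle_tape_def)
  then have "(\<lambda>x. Q x ((step p (b x) ^^ Suc k) c)) = (\<lambda>x. if i < 0
      then Q x ((step p (b x) ^^ k) (next_config None)) else if b x (nat i)
      then Q x ((step p (b x) ^^ k) (next_config (Some True)))
      else Q x ((step p (b x) ^^ k) (next_config (Some False))))"
    by (auto simp: funpow_Suc_right simp del: funpow.simps)
  moreover note [measurable] = b Suc
  ultimately show ?case by simp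
qed (simp add: Q)

lemma pred_computed [measurable (raw)]:
  assumes [measurable]: "\<And>n. Measurable.pred M (\<lambda>x. b x n)"
  shows "Measurable.pred M (\<lambda>x. computed p (b x) n)"
proof -
  have [measurable]: "Measurable.pred M (\<lambda>x. halted p (b x) c)" for c
  proof -
    define h where "h o' \<longleftrightarrow> p (state c, work_tape c (work_head c), o') = None" for o'
    have "halted p b' c \<longleftrightarrow> (if oracle_head c < 0 then h None else
        if b' (nat (oracle_head c)) then h (Some True) else h (Some False))" for b'
      by (cases "b' (nat (oracle_head c))") (simp_all add: halted_def scanned_def oracle_tape_def h_def)
    then show ?thesis by simp
  qed
  have "Measurable.pred M (\<lambda>x. \<exists>k. halted p (b x) ((step p (b x) ^^ k) (initial_config n)) \<and>
      work_tape ((step p (b x) ^^ k) (initial_config n)) (work_head ((step p (b x) ^^ k) (initial_config n))) = 1)"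
    by (intro pred_intros_countable)
       (rule pred_iterate_step[where Q="\<lambda>x c. halted p (b x) c \<and> work_tape c (work_head c) = 1"], measurable)
  then show ?thesis by (simp add: computed_def Let_def)
qed

section \<open>Decoding points of a Polish space from bit sequences\<close>

lemma dense_sequence:
  obtains D :: "nat \<Rightarrow> 'a::second_countable_topology" where "\<And>V. open V \<Longrightarrow> V \<noteq> {} \<Longrightarrow> \<exists>i. D i \<in> V"
proof -
  obtain S :: "'a set" where S: "countable S" "\<And>V. open V \<Longrightarrow> V \<noteq> {} \<Longrightarrow> \<exists>d\<in>S. d \<in> V"
    using countable_dense_setE by blast
  then have "S \<noteq> {}" by (metis UNIV_not_empty empty_iff open_UNIV)
  then have "\<exists>i. from_nat_into S i \<in> V" if "open V" "V \<noteq> {}" for V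
    using S(2)[OF that] S(1) by (metis from_nat_into_surj)
  then show ?thesis by (rule that)
qed

text \<open>A sequence \<open>a\<close> is read as a matrix. The first bit set in row
  \<open>n\<close> selects the \<open>n\<close>-th point of a sequence in a dense set, and
  \<open>a\<close> names the limit. Each selection is Borel in the bits, hence so is the
  limit.\<close>

lemma polish_decoding:
  obtains \<kappa> :: "(nat \<Rightarrow> bool) \<Rightarrow> 'a::polish_space"
  where "surj \<kappa>"
    and "\<And>(M :: 'm measure) b. (\<And>n. Measurable.pred M (\<lambda>x. b x n)) \<Longrightarrow> (\<lambda>x. \<kappa> (b x)) \<in> borel_measurable M"
proof -
  obtain D :: "nat \<Rightarrow> 'a" where D: "\<And>V. open V \<Longrightarrow> V \<noteq> {} \<Longrightarrow> \<exists>i. D i \<in> V"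
    using dense_sequence by blast
  define s where "s a n = D (LEAST i. a (prod_encode (n, i)))" for a n
  \<comment> \<open>The constant default makes the limit exist for every \<open>a\<close>, so that
    \<kappa> is everywhere a pointwise limit of Borel maps.\<close>
  define t where "t a n = (if Cauchy (s a) then s a n else D 0)" for a n
  define \<kappa> where "\<kappa> a = lim (t a)" for a
  have lim: "t a \<longlonglongrightarrow> \<kappa> a" for a
  proof -
    have "Cauchy (t a)"
      by (cases "Cauchy (s a)") (auto simp: t_def[abs_def] LIMSEQ_imp_Cauchy[OF tendsto_const])
    then show ?thesis unfolding \<kappa>_def
      using Cauchy_convergent convergent_LIMSEQ_iff by blast
  qed
  show ?thesis
  proof (rule that[of \<kappa>])
    have "k \<in> range \<kappa>" for k
    proof -
      \<comment> \<open>Row \<open>n\<close> marks every dense point within \<open>(1/2)^n\<close>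
        of \<open>k\<close>.\<close>
      define a where "a m = (case prod_decode m of (n, i) \<Rightarrow> dist (D i) k < (1/2)^n)" for m
      have "dist (s a n) k < (1/2)^n" for n
      proof -
        have "ball k ((1/2)^n) \<noteq> {}" by (simp add: not_le)
        then obtain i where "D i \<in> ball k ((1/2)^n)" using D[OF open_ball] by blast
        then have "\<exists>i. dist (D i) k < (1/2)^n" by (auto simp: dist_commute)
        then have "\<exists>i. a (prod_encode (n, i))" by (simp add: a_def)
        then have "a (prod_encode (n, LEAST i. a (prod_encode (n, i))))" by (rule LeastI_ex)
        then show ?thesis by (simp add: a_def s_def)
      qed
      then have bound: "norm (dist (s a n) k) \<le> (1/2)^n" for n by (simp add: less_imp_le)
      have "(\<lambda>n. dist (s a n) k) \<longlonglongrightarrow> 0"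
        by (rule Lim_null_comparison[OF always_eventually LIMSEQ_realpow_zero[of "1/2"]])
           (use bound in auto)
      then have "s a \<longlonglongrightarrow> k" by (rule tendsto_dist_iff[THEN iffD2])
      then have "t a \<longlonglongrightarrow> k"
        by (simp add: t_def[abs_def] LIMSEQ_imp_Cauchy)
      then show ?thesis using lim LIMSEQ_unique by blast
    qed
    then show "surj \<kappa>" by blast
  next
    fix M :: "'m measure" and b :: "'m \<Rightarrow> nat \<Rightarrow> bool"
    assume [measurable]: "\<And>n. Measurable.pred M (\<lambda>x. b x n)"
    have [measurable]: "(\<lambda>x. s (b x) n) \<in> borel_measurable M" for n
      unfolding s_def by measurable
    have "(\<lambda>x. t (b x) n) \<in> borel_measurable M" for n
      unfolding t_def by measurable
    then show "(\<lambda>x. \<kappa> (b x)) \<in> borel_measurable M"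
      by (rule borel_measurable_LIMSEQ_metric) (rule lim)
  qed
qed

instance prod :: (polish_space, polish_space) polish_space ..

lemma pred_coordinate_borel:
  fixes f :: "'x::topological_space \<Rightarrow> nat \<Rightarrow> bool"
  assumes "f \<in> borel_measurable borel"
  shows "Measurable.pred borel (\<lambda>x. f x n)"
proof -
  have "open ((\<lambda>b :: nat \<Rightarrow> bool. b n) -` {True})"
    by (intro open_vimage open_discrete continuous_on_product_coordinates)
  then have "f -` ((\<lambda>b. b n) -` {True}) \<inter> space borel \<in> sets borel"
    using assms by (intro measurable_sets[OF assms]) simp
  then show ?thesis by (simp add: pred_def vimage_def)
qed

lemma measurable_fst_borel [measurable]: "fst \<in> borel_measurable borel"
  and measurable_snd_borel [measurable]: "snd \<in> borel_measurable borel"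
  by (intro borel_measurable_continuous_onI continuous_intros)+

lemma coding_maps:
  fixes E :: "('x::polish_space \<times> 'x) set"
  assumes "borel_coding_property E"
  obtains \<psi> :: "nat \<Rightarrow> 'x \<Rightarrow> 'x"
  where "\<And>i. \<psi> i \<in> borel_measurable borel"
    and "\<And>x y. \<exists>v i j. (x, v) \<in> E \<and> \<psi> i v = x \<and> \<psi> j v = y"
proof -
  obtain f :: "'x \<Rightarrow> nat \<Rightarrow> bool" where f: "f \<in> borel_measurable borel"
    "\<And>x a. \<exists>y. (x, y) \<in> E \<and> turing_computes (f y) a"
    using assms unfolding borel_coding_property_def by blast
  obtain \<xi> :: "(nat \<Rightarrow> bool) \<Rightarrow> 'x \<times> 'x" where "surj \<xi>" and
    \<xi>: "\<And>(M :: 'x measure) b. (\<And>n. Measurable.pred M (\<lambda>x. b x n)) \<Longrightarrow> (\<lambda>x. \<xi> (b x)) \<in> borel_measurable M"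
    using polish_decoding by blast
  define P where "P = from_nat_into {p :: oracle_program. finite (dom p)}"
  \<comment> \<open>The program with index \<open>i div 2\<close> runs on the code of
    \<open>v\<close>, its output names a pair of points, and the parity of \<open>i\<close> selects
    the component.\<close>
  define \<psi> where "\<psi> i v = (if even i then fst else snd) (\<xi> (computed (P (i div 2)) (f v)))" for i v
  show ?thesis
  proof (rule that[of \<psi>])
    have "(\<lambda>v. \<xi> (computed p (f v))) \<in> borel_measurable borel" for p
      by (intro \<xi> pred_computed pred_coordinate_borel f(1))
    then show "\<psi> i \<in> borel_measurable borel" for i
      unfolding \<psi>_def by (cases "even i") (auto intro: measurable_compose)
  next
    fix x y
    obtain a where a: "\<xi> a = (x, y)" using \<open>surj \<xi>\<close> by (metis surjD)
    obtain v where v: "(x, v) \<in> E" "turing_computes (f v) a" using f(2) by blast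
    obtain p where p: "finite (dom p)" "computed p (f v) = a"
      using turing_computes_imp_computed[OF v(2)] .
    obtain k where "P k = p"
      unfolding P_def using from_nat_into_surj[OF countable_programs, of p] p(1) by auto
    then have "\<psi> (2 * k) v = x" "\<psi> (2 * k + 1) v = y" using a p(2) by (simp_all add: \<psi>_def)
    then show "\<exists>v i j. (x, v) \<in> E \<and> \<psi> i v = x \<and> \<psi> j v = y" using v(1) by blast
  qed
qed

section \<open>Uncountability of the classes\<close>

lemma uncountable_bool_sequences: "uncountable (UNIV :: (nat \<Rightarrow> bool) set)"
proof
  assume "countable (UNIV :: (nat \<Rightarrow> bool) set)"
  then obtain s :: "nat \<Rightarrow> nat \<Rightarrow> bool" where "range s = UNIV"
    by (metis UNIV_not_empty range_from_nat_into)
  then obtain n where "s n = (\<lambda>k. \<not> s k k)" by (metis surjD)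
  then show False by (metis (full_types))
qed

text \<open>Every sequence is computed by the code of some member of the class, while a single code
  computes only countably many sequences.\<close>

lemma uncountable_class:
  assumes "borel_coding_property E"
  shows "uncountable {y. (x, y) \<in> E}"
proof
  assume c: "countable {y. (x, y) \<in> E}"
  obtain f where "\<And>a. \<exists>y. (x, y) \<in> E \<and> turing_computes (f y) a"
    using assms unfolding borel_coding_property_def by blast
  then have "UNIV = (\<Union>y\<in>{y. (x, y) \<in> E}. {a. turing_computes (f y) a})" by auto
  moreover have "countable \<dots>" using c by (intro countable_UN countable_turing_computes)
  ultimately show False using uncountable_bool_sequences by simp
qed

section \<open>Coding bits by nearby points of an orbit\<close>

lemma dist_tail_le:
  fixes s :: "nat \<Rightarrow> 'a::metric_space"
  assumes "\<And>n. n \<ge> m \<Longrightarrow> dist (s n) (s (Suc n)) \<le> c * (1/2)^n"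
  shows "dist (s m) (s (m + k)) \<le> 2 * c * (1/2)^m"
proof -
  have c: "0 \<le> c"
    using order_trans[OF zero_le_dist assms[of m]] zero_less_power[of "1/2::real" m]
    by (auto simp: zero_le_mult_iff simp del: zero_less_power)
  \<comment> \<open>The exact partial geometric sum is kept, so that the induction closes.\<close>
  have "dist (s m) (s (m + k)) \<le> 2 * c * ((1/2)^m - (1/2)^(m + k))"
  proof (induction k)
    case (Suc k)
    have "dist (s m) (s (m + Suc k)) \<le> dist (s m) (s (m + k)) + dist (s (m + k)) (s (m + Suc k))"
      by (rule dist_triangle)
    also have "\<dots> \<le> 2 * c * ((1/2)^m - (1/2)^(m + k)) + c * (1/2)^(m + k)"
      using Suc assms[of "m + k"] by simp
    finally show ?case by (simp add: algebra_simps)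
  qed simp
  also have "\<dots> \<le> 2 * c * (1/2)^m"
    using c by (intro mult_left_mono) auto
  finally show ?thesis .
qed

lemma dist_limit_le:
  fixes s :: "nat \<Rightarrow> 'a::metric_space"
  assumes "\<And>n. n \<ge> m \<Longrightarrow> dist (s n) (s (Suc n)) \<le> c * (1/2)^n" and "s \<longlonglongrightarrow> l"
  shows "dist (s m) l \<le> 2 * c * (1/2)^m"
proof (rule Lim_bounded)
  show "(\<lambda>n. dist (s m) (s n)) \<longlonglongrightarrow> dist (s m) l"
    using assms(2) by (intro tendsto_intros)
  show "\<forall>n\<ge>m. dist (s m) (s n) \<le> 2 * c * (1/2)^m"
    using dist_tail_le[of m s c, OF assms(1)] by (metis le_add_diff_inverse)
qed

lemma Cauchy_geometric:
  fixes s :: "nat \<Rightarrow> 'a::metric_space"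
  assumes "\<And>n. dist (s n) (s (Suc n)) \<le> (1/2)^n"
  shows "Cauchy s"
proof (rule metric_CauchyI)
  fix e :: real assume "0 < e"
  then obtain N where N: "(1/2)^N < e / 4"
    using real_arch_pow_inv[of "e/4" "1/2"] by auto
  have "dist (s m) (s n) < e" if "N \<le> m" "N \<le> n" for m n
  proof -
    have "dist (s N) (s j) < e / 2" if "N \<le> j" for j
      using dist_tail_le[of N s 1 "j - N"] assms N that by simp
    then have "dist (s N) (s m) < e / 2" "dist (s N) (s n) < e / 2" using that by auto
    then show ?thesis by (metis dist_commute dist_triangle_half_r)
  qed
  then show "\<exists>N. \<forall>m\<ge>N. \<forall>n\<ge>N. dist (s m) (s n) < e" by blast
qed

text \<open>New terms are added on the right: \<open>d\<close> then acts on \<open>x\<close> before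
  the earlier terms do, so if \<open>d\<close> moves \<open>x\<close>, adding \<open>d\<close> to
  any partial sum changes the resulting point.\<close>

primrec subsum :: "(nat \<Rightarrow> 'g::monoid_add) \<Rightarrow> (nat \<Rightarrow> bool) \<Rightarrow> nat \<Rightarrow> 'g" where
  "subsum e a 0 = 0"
| "subsum e a (Suc n) = subsum e a n + (if a n then e n else 0)"

lemma subsum_cong:
  assumes "\<And>m. m < n \<Longrightarrow> e m = e' m" "\<And>m. m < n \<Longrightarrow> a m = a' m"
  shows "subsum e a n = subsum e' a' n"
  using assms by (induction n) auto

text \<open>No stabilizer contains a neighbourhood of 0, and this is witnessed inside a sequence, so
  that a moving element can be chosen by least index and hence in a Borel way.\<close>

locale moving_action =
  fixes act :: "'g::{polish_space, topological_group_add} \<Rightarrow> 'x::polish_space \<Rightarrow> 'x"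
    and D :: "nat \<Rightarrow> 'g"
  assumes action: "continuous_action act"
    and moving: "\<And>V x. open V \<Longrightarrow> 0 \<in> V \<Longrightarrow> \<exists>i. D i \<in> V \<and> act (D i) x \<noteq> x"
begin

lemma act_0 [simp]: "act 0 x = x"
  and act_add: "act (g + h) x = act g (act h x)"
  using action by (auto simp: continuous_action_def)

lemma act_cancel [simp]: "act g x = act g y \<longleftrightarrow> x = y"
  by (metis act_0 act_add left_minus)

lemma continuous_act: "continuous_on UNIV (\<lambda>p. act (fst p) (snd p))"
  using action by (auto simp: continuous_action_def case_prod_beta)

lemma tendsto_act:
  assumes "(g \<longlongrightarrow> h) F" "(y \<longlongrightarrow> x) F"
  shows "((\<lambda>z. act (g z) (y z)) \<longlongrightarrow> act h x) F"
  using continuous_on_tendsto_compose[OF continuous_act tendsto_Pair[OF assms]] by simp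

lemma measurable_act [measurable (raw)]:
  assumes "g \<in> borel_measurable M" "y \<in> borel_measurable M"
  shows "(\<lambda>z. act (g z) (y z)) \<in> borel_measurable M"
  using assms by (rule borel_measurable_continuous_Pair) (rule continuous_act)

text \<open>The last condition makes all later displacements along \<open>A\<close> add up to less than half of the gap
  opened at stage \<open>m\<close>, so that the \<open>m\<close>-th bit can be read off from the limit point.\<close>

definition good :: "'x \<Rightarrow> (nat \<Rightarrow> 'g) \<Rightarrow> nat \<Rightarrow> 'g \<Rightarrow> bool" where
  "good x e n d \<longleftrightarrow> act d x \<noteq> x \<and> (\<forall>A\<in>Pow {..<n}.
     dist (subsum e (\<lambda>i. i \<in> A) n) (subsum e (\<lambda>i. i \<in> A) n + d) < (1/2)^n \<and>
     (\<forall>m<n. dist (act (subsum e (\<lambda>i. i \<in> A) n) x) (act (subsum e (\<lambda>i. i \<in> A) n + d) x)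
        < (1/2)^(n + 2) * dist (act (subsum e (\<lambda>i. i \<in> A) m) x) (act (subsum e (\<lambda>i. i \<in> A) m + e m) x)))"

lemma good_cong:
  assumes "\<And>m. m < n \<Longrightarrow> e m = e' m"
  shows "good x e n d = good x e' n d"
proof -
  have "subsum e a m = subsum e' a m" if "m \<le> n" for a m
    using that assms by (intro subsum_cong) auto
  then show ?thesis using assms unfolding good_def by (simp cong: conj_cong)
qed

text \<open>Only the first \<open>n\<close> bits of \<open>a\<close> matter. Replacing sequences by
  subsets of \<open>{..<n}\<close> keeps \<open>good\<close> a finite conjunction, as needed for
  neighbourhoods and measurability.\<close>

lemma goodD:
  assumes "good x e n d"
  shows "act d x \<noteq> x"
    and "dist (subsum e a n) (subsum e a n + d) < (1/2)^n"
    and "m < n \<Longrightarrow> dist (act (subsum e a n) x) (act (subsum e a n + d) x)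
        < (1/2)^(n + 2) * dist (act (subsum e a m) x) (act (subsum e a m + e m) x)"
proof -
  define A where "A = {i. i < n \<and> a i}"
  have "subsum e a m = subsum e (\<lambda>i. i \<in> A) m" if "m \<le> n" for m
    using that by (intro subsum_cong) (auto simp: A_def)
  moreover have "A \<in> Pow {..<n}" by (auto simp: A_def)
  ultimately show "act d x \<noteq> x"
    and "dist (subsum e a n) (subsum e a n + d) < (1/2)^n"
    and "m < n \<Longrightarrow> dist (act (subsum e a n) x) (act (subsum e a n + d) x)
        < (1/2)^(n + 2) * dist (act (subsum e a m) x) (act (subsum e a m + e m) x)"
    using assms unfolding good_def by auto
qed

text \<open>Apart from moving \<open>x\<close>, the conditions on \<open>d\<close> are finitely many
  strict inequalities between continuous functions that hold at 0: the left sides vanish there, and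
  the gaps on the right are positive since each \<open>e m\<close> moves \<open>x\<close>. They hold
  on a neighbourhood of 0, where \<open>moving\<close> supplies \<open>D i\<close>.\<close>

lemma ex_good:
  assumes "\<And>m. m < n \<Longrightarrow> act (e m) x \<noteq> x"
  shows "\<exists>i. good x e n (D i)"
proof -
  have lt: "eventually (\<lambda>d. dist (\<phi> 0) (\<phi> d) < r) (nhds (0::'g))"
    if "(\<phi> \<longlongrightarrow> \<phi> 0) (nhds 0)" "0 < r" for \<phi> :: "'g \<Rightarrow> 'b::metric_space" and r
    using tendstoD[OF that] by (simp add: dist_commute)
  have "eventually (\<lambda>d. dist (subsum e a n) (subsum e a n + d) < (1/2)^n) (nhds 0)" for a
  proof -
    have "((\<lambda>d. subsum e a n + d) \<longlongrightarrow> subsum e a n + 0) (nhds 0)"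
      by (intro tendsto_intros filterlim_ident)
    then show ?thesis using lt[of "\<lambda>d. subsum e a n + d" "(1/2)^n"] by simp
  qed
  moreover have "eventually (\<lambda>d. dist (act (subsum e a n) x) (act (subsum e a n + d) x)
        < (1/2)^(n + 2) * dist (act (subsum e a m) x) (act (subsum e a m + e m) x)) (nhds 0)"
    if "m < n" for a m
  proof -
    have "((\<lambda>d. act (subsum e a n + d) x) \<longlongrightarrow> act (subsum e a n + 0) x) (nhds 0)"
      by (intro tendsto_act tendsto_intros filterlim_ident)
    moreover have "0 < (1/2)^(n + 2) * dist (act (subsum e a m) x) (act (subsum e a m + e m) x)"
      using assms[OF that] by (simp add: act_add eq_commute)
    ultimately show ?thesis
      using lt[of "\<lambda>d. act (subsum e a n + d) x"] by (simp only: add_0_right)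
  qed
  ultimately have "eventually (\<lambda>d. \<forall>A\<in>Pow {..<n}.
     dist (subsum e (\<lambda>i. i \<in> A) n) (subsum e (\<lambda>i. i \<in> A) n + d) < (1/2)^n \<and>
     (\<forall>m\<in>{..<n}. dist (act (subsum e (\<lambda>i. i \<in> A) n) x) (act (subsum e (\<lambda>i. i \<in> A) n + d) x)
        < (1/2)^(n + 2) * dist (act (subsum e (\<lambda>i. i \<in> A) m) x) (act (subsum e (\<lambda>i. i \<in> A) m + e m) x)))
     (nhds 0)"
    by (intro eventually_ball_finite eventually_conj ballI) auto
  then obtain V where V: "open V" "0 \<in> V" "\<And>d. d \<in> V \<Longrightarrow> \<forall>A\<in>Pow {..<n}.
     dist (subsum e (\<lambda>i. i \<in> A) n) (subsum e (\<lambda>i. i \<in> A) n + d) < (1/2)^n \<and>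
     (\<forall>m\<in>{..<n}. dist (act (subsum e (\<lambda>i. i \<in> A) n) x) (act (subsum e (\<lambda>i. i \<in> A) n + d) x)
        < (1/2)^(n + 2) * dist (act (subsum e (\<lambda>i. i \<in> A) m) x) (act (subsum e (\<lambda>i. i \<in> A) m + e m) x))"
    unfolding eventually_nhds by blast
  obtain i where "D i \<in> V" "act (D i) x \<noteq> x" using moving[OF V(1,2)] by blast
  then show ?thesis unfolding good_def using V(3) by blast
qed

text \<open>The history records indices instead of group elements, so it takes countably many values
  and measurability can be checked for each fixed history.\<close>

primrec choices :: "'x \<Rightarrow> nat \<Rightarrow> nat list" where
  "choices x 0 = []"
| "choices x (Suc n) = choices x n @ [LEAST i. good x (\<lambda>m. D (choices x n ! m)) n (D i)]"

definition shift_by :: "'x \<Rightarrow> nat \<Rightarrow> 'g" where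
  "shift_by x n = D (choices x (Suc n) ! n)"

lemma length_choices [simp]: "length (choices x n) = n"
  by (induction n) auto

lemma nth_choices: "m < n \<Longrightarrow> D (choices x n ! m) = shift_by x m"
proof (induction n)
  case (Suc n)
  then show ?case by (cases "m = n") (auto simp: shift_by_def nth_append simp del: choices.simps(1))
qed simp

lemma good_shift_by: "good x (shift_by x) n (shift_by x n)"
proof (induction n rule: less_induct)
  case (less n)
  have "\<exists>i. good x (\<lambda>m. D (choices x n ! m)) n (D i)"
    by (rule ex_good) (simp add: nth_choices goodD(1)[OF less])
  then have "good x (\<lambda>m. D (choices x n ! m)) n (D (LEAST i. good x (\<lambda>m. D (choices x n ! m)) n (D i)))"
    by (rule LeastI_ex)
  moreover have "shift_by x n = D (LEAST i. good x (\<lambda>m. D (choices x n ! m)) n (D i))"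
    by (simp add: shift_by_def nth_append)
  ultimately show ?case using good_cong[of n "\<lambda>m. D (choices x n ! m)" "shift_by x" x] nth_choices
    by simp
qed

lemma measurable_choices [measurable]: "(\<lambda>x. choices x n) \<in> borel \<rightarrow>\<^sub>M count_space UNIV"
proof (induction n)
  case (Suc n)
  have [measurable]: "Measurable.pred borel (\<lambda>x. good x e k d)" for e k d
  proof -
    have "(\<lambda>x. good x e k d) = (\<lambda>x. dist (act d x) x \<noteq> 0 \<and> (\<forall>A\<in>Pow {..<k}.
     dist (subsum e (\<lambda>i. i \<in> A) k) (subsum e (\<lambda>i. i \<in> A) k + d) < (1/2)^k \<and>
     (\<forall>m\<in>{..<k}. dist (act (subsum e (\<lambda>i. i \<in> A) k) x) (act (subsum e (\<lambda>i. i \<in> A) k + d) x)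
        < (1/2)^(k + 2) * dist (act (subsum e (\<lambda>i. i \<in> A) m) x) (act (subsum e (\<lambda>i. i \<in> A) m + e m) x))))"
      unfolding good_def by auto
    also have "Measurable.pred borel \<dots>"
      by (intro pred_intros_logic pred_intros_finite finite_Pow_iff[THEN iffD2] finite_lessThan) measurable
    finally show ?thesis .
  qed
  \<comment> \<open>The history is decoupled from \<open>x\<close> as a parameter \<open>l\<close>
    ranging over a countable set.\<close>
  have "(\<lambda>x. (\<lambda>l x. l @ [LEAST i. good x (\<lambda>m. D (l ! m)) n (D i)]) (choices x n) x) \<in> borel \<rightarrow>\<^sub>M count_space UNIV"
    by (rule measurable_compose_countable[OF _ Suc]) measurable
  then show ?case by simp
qed simp

lemma measurable_shift_by [measurable (raw)]:
  assumes "y \<in> borel_measurable M"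
  shows "(\<lambda>z. shift_by (y z) n) \<in> borel_measurable M"
proof -
  have "(\<lambda>x. D (choices x (Suc n) ! n)) \<in> borel_measurable borel"
    by (rule measurable_compose[OF measurable_choices]) simp
  from measurable_compose[OF assms this] show ?thesis by (simp add: shift_by_def)
qed

section \<open>Coding points and their decoding\<close>

definition coding_element :: "'x \<Rightarrow> (nat \<Rightarrow> bool) \<Rightarrow> 'g" where
  "coding_element x a = lim (subsum (shift_by x) a)"

definition coding_point :: "'x \<Rightarrow> (nat \<Rightarrow> bool) \<Rightarrow> 'x" where
  "coding_point x a = act (coding_element x a) x"

text \<open>The metric is not assumed invariant, which is why \<open>good\<close> bounds the
  displacement after every partial sum.\<close>

lemma coding_element_tendsto: "subsum (shift_by x) a \<longlonglongrightarrow> coding_element x a"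
proof -
  have "dist (subsum (shift_by x) a n) (subsum (shift_by x) a (Suc n)) \<le> (1/2)^n" for n
    using goodD(2)[OF good_shift_by[of x n], of a] by auto
  then have "Cauchy (subsum (shift_by x) a)" by (rule Cauchy_geometric)
  then show ?thesis unfolding coding_element_def
    using Cauchy_convergent convergent_LIMSEQ_iff by blast
qed

lemma measurable_coding_point [measurable (raw)]:
  assumes [measurable]: "y \<in> borel_measurable M" "\<And>n. Measurable.pred M (\<lambda>z. a z n)"
  shows "(\<lambda>z. coding_point (y z) (a z)) \<in> borel_measurable M"
proof -
  have "(\<lambda>z. subsum (shift_by (y z)) (a z) n) \<in> borel_measurable M" for n
    by (induction n) simp_all
  then have [measurable]: "(\<lambda>z. coding_element (y z) (a z)) \<in> borel_measurable M"
    by (rule borel_measurable_LIMSEQ_metric) (rule coding_element_tendsto)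
  show ?thesis unfolding coding_point_def by measurable
qed

text \<open>Greedy nearest-point decoding.\<close>

primrec decode_sum :: "'x \<Rightarrow> 'x \<Rightarrow> nat \<Rightarrow> 'g" where
  "decode_sum x u 0 = 0"
| "decode_sum x u (Suc n) =
    (if dist u (act (decode_sum x u n + shift_by x n) x) < dist u (act (decode_sum x u n) x)
     then decode_sum x u n + shift_by x n else decode_sum x u n)"

definition decode :: "'x \<Rightarrow> 'x \<Rightarrow> nat \<Rightarrow> bool" where
  "decode x u n \<longleftrightarrow> dist u (act (decode_sum x u n + shift_by x n) x) < dist u (act (decode_sum x u n) x)"

lemma measurable_decode [measurable (raw)]:
  assumes [measurable]: "y \<in> borel_measurable M" "u \<in> borel_measurable M"
  shows "Measurable.pred M (\<lambda>z. decode (y z) (u z) n)"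
proof -
  have [measurable]: "(\<lambda>z. decode_sum (y z) (u z) n) \<in> borel_measurable M" for n
    by (induction n) simp_all
  show ?thesis unfolding decode_def by measurable
qed

text \<open>At stage \<open>n\<close> the two candidates lie at distance \<delta>. All later
  displacements together amount to at most a quarter of \<delta>, so the limit \<open>u\<close> is
  strictly nearer to the candidate chosen by \<open>a n\<close>. Hence the greedy sums follow the
  true ones.\<close>

lemma decode_coding_point: "decode x (coding_point x a) = a"
proof -
  define u where "u = coding_point x a"
  define w where "w n = act (subsum (shift_by x) a n) x" for n
  have lim: "w \<longlonglongrightarrow> u"
    unfolding w_def[abs_def] u_def coding_point_def
    by (intro tendsto_act coding_element_tendsto tendsto_const)
  have bit: "a n \<longleftrightarrow> dist u (act (subsum (shift_by x) a n + shift_by x n) x) < dist u (w n)" for n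
  proof -
    define w1 where "w1 = act (subsum (shift_by x) a n + shift_by x n) x"
    define \<delta> where "\<delta> = dist (w n) w1"
    have "\<delta> > 0"
      using goodD(1)[OF good_shift_by, of x n] by (auto simp: \<delta>_def w_def w1_def act_add)
    \<comment> \<open>The factor \<open>(1/2)^(k + 2)\<close> in \<open>good\<close> at stage
      \<open>k\<close>, taken for the gap of stage \<open>n\<close>, supplies the quarter.\<close>
    have "dist (w k) (w (Suc k)) \<le> \<delta>/4 * (1/2)^k" if "Suc n \<le> k" for k
    proof (cases "a k")
      case True
      then show ?thesis using goodD(3)[OF good_shift_by[of x k], of n a] that
        by (simp add: w_def w1_def \<delta>_def mult.commute)
    next
      case False
      then show ?thesis using \<open>\<delta> > 0\<close> by (simp add: w_def)
    qed
    then have "dist (w (Suc n)) u \<le> 2 * (\<delta>/4) * (1/2)^Suc n"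
      using lim by (rule dist_limit_le)
    also have "\<dots> \<le> \<delta>/4 * 1"
      using \<open>\<delta> > 0\<close> by (simp add: power_le_one)
    finally have "dist (w (Suc n)) u \<le> \<delta>/4" by simp
    moreover have "w (Suc n) = (if a n then w1 else w n)" by (simp add: w_def w1_def)
    moreover have "\<delta> \<le> dist (w n) u + dist u w1" unfolding \<delta>_def by (rule dist_triangle)
    ultimately show ?thesis
      using \<open>\<delta> > 0\<close> unfolding w1_def[symmetric] by (auto simp: dist_commute split: if_splits)
  qed
  have "decode_sum x u n = subsum (shift_by x) a n" for n
    using bit by (induction n) (auto simp: w_def)
  then show ?thesis
    using bit unfolding decode_def w_def u_def by auto
qed

end

section \<open>Graphs of prescribed diameter\<close>

text \<open>Powers of the reflexive closure thus express distance at most \<open>n\<close>, the form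
  in which all diameter bounds below are stated.\<close>

lemma relpow_reflcl_iff: "(x, y) \<in> (G\<^sup>=) ^^ n \<longleftrightarrow> (\<exists>m\<le>n. (x, y) \<in> G ^^ m)"
proof (induction n arbitrary: y)
  case (Suc n)
  have "(x, y) \<in> (G\<^sup>=) ^^ Suc n \<longleftrightarrow>
      (\<exists>m\<le>n. (x, y) \<in> G ^^ m) \<or> (\<exists>m\<le>n. (x, y) \<in> G ^^ Suc m)"
    using Suc by fastforce
  also have "\<dots> \<longleftrightarrow> (\<exists>m\<le>Suc n. (x, y) \<in> G ^^ m)"
    by (metis le_Suc_eq not0_implies_Suc Suc_le_mono zero_le)
  finally show ?case .
qed auto

lemma graph_diameter_eqI:
  assumes "G\<^sup>* \<subseteq> (G\<^sup>=) ^^ Suc n" "\<not> G\<^sup>* \<subseteq> (G\<^sup>=) ^^ n"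
  shows "graph_diameter G = enat (Suc n)"
proof (rule antisym)
  have "graph_distance G x y \<le> Suc n" if xy: "(x, y) \<in> G\<^sup>*" for x y
  proof -
    obtain m where "m \<le> Suc n" "(x, y) \<in> G ^^ m"
      using subsetD[OF assms(1) xy] by (auto simp only: relpow_reflcl_iff)
    then show ?thesis unfolding graph_distance_def by (meson Least_le order_trans)
  qed
  then show "graph_diameter G \<le> enat (Suc n)"
    unfolding graph_diameter_def by (auto intro!: SUP_least)
next
  obtain x y where xy: "(x, y) \<in> G\<^sup>*" "(x, y) \<notin> (G\<^sup>=) ^^ n" using assms(2) by auto
  have "(x, y) \<in> G ^^ graph_distance G x y"
    unfolding graph_distance_def using rtrancl_imp_relpow[OF xy(1)] by (metis LeastI)
  then have "Suc n \<le> graph_distance G x y"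
    using xy(2) relpow_reflcl_iff[of x y n G] by (metis not_less_eq_eq)
  also have "enat (graph_distance G x y) \<le> graph_diameter G"
    unfolding graph_diameter_def using xy(1) by (intro SUP_upper2[of "(x, y)"]) auto
  finally show "enat (Suc n) \<le> graph_diameter G" by simp
qed

lemma rtrancl_eqI:
  assumes "equiv UNIV E" "G \<subseteq> E" "E \<subseteq> (G\<^sup>=) ^^ n"
  shows "G\<^sup>* = E"
proof
  have "E\<^sup>* = E"
    using assms(1) by (auto simp: equiv_def refl_on_def trancl_id simp flip: trancl_reflcl)
  then show "G\<^sup>* \<subseteq> E" using rtrancl_mono[OF assms(2)] by simp
  show "E \<subseteq> G\<^sup>*"
  proof
    fix p assume "p \<in> E"
    then have "p \<in> (G\<^sup>=)\<^sup>*" using assms(3) relpow_imp_rtrancl by blast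
    then show "p \<in> G\<^sup>*" by simp
  qed
qed

text \<open>The vertex \<open>q\<close> is merged into \<open>h\<close> and then reattached as a pendant vertex at \<open>t\<close>. The 1-Lipschitz
  function \<open>\<phi>\<close> is a lower bound for distances along the tail built in this way.\<close>

lemma attach_pendant_vertex:
  fixes E :: "('x::polish_space \<times> 'x) set" and \<phi> :: "'x \<Rightarrow> nat"
  assumes E: "equiv UNIV E"
    and G: "borel_graph G" "G \<subseteq> E" "E \<subseteq> (G\<^sup>=) ^^ n"
    and q: "(q, h) \<in> E" "(q, t) \<in> E" "q \<noteq> h" "q \<noteq> t"
    and \<phi>: "\<And>a b. (a, b) \<in> G \<Longrightarrow> \<phi> a \<le> \<phi> b + 1" "\<phi> q = 0" "\<phi> h = 0"
  obtains G' where "borel_graph G'" "G' \<subseteq> E" "E \<subseteq> (G'\<^sup>=) ^^ Suc n"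
    "\<And>a b. (a, b) \<in> G' \<Longrightarrow> (\<phi>(q := \<phi> t + 1)) a \<le> (\<phi>(q := \<phi> t + 1)) b + 1"
proof -
  \<comment> \<open>Edges at \<open>q\<close> are rerouted to \<open>h\<close>, and the only edge
    left at \<open>q\<close> is the new one to \<open>t\<close>.\<close>
  define G' where "G' = {(a, b). a \<noteq> b \<and> (a \<noteq> q \<and> b \<noteq> q \<and>
      ((a, b) \<in> G \<or> a = h \<and> (q, b) \<in> G \<or> b = h \<and> (a, q) \<in> G) \<or> a = q \<and> b = t \<or> a = t \<and> b = q)}"
  have symG: "(a, b) \<in> G \<Longrightarrow> (b, a) \<in> G" for a b
    using G(1) by (auto simp: borel_graph_def dest: symD)
  have symE: "(a, b) \<in> E \<Longrightarrow> (b, a) \<in> E" and transE: "(a, b) \<in> E \<Longrightarrow> (b, c) \<in> E \<Longrightarrow> (a, c) \<in> E"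
    and reflE: "(a, a) \<in> E" for a b c
    using E by (auto simp: equiv_def dest: symD transD reflD)
  have [measurable]: "G \<in> sets borel" using G(1) by (simp add: borel_graph_def)
  have "G' = {p \<in> space borel. dist (fst p) (snd p) \<noteq> 0 \<and> (dist (fst p) q \<noteq> 0 \<and> dist (snd p) q \<noteq> 0 \<and>
      ((fst p, snd p) \<in> G \<or> dist (fst p) h = 0 \<and> (q, snd p) \<in> G \<or> dist (snd p) h = 0 \<and> (fst p, q) \<in> G)
      \<or> dist (fst p) q = 0 \<and> dist (snd p) t = 0 \<or> dist (fst p) t = 0 \<and> dist (snd p) q = 0)}"
    by (simp add: G'_def set_eq_iff)
  also have "\<dots> \<in> sets borel" by measurable
  finally have "G' \<in> sets borel" .
  moreover have "sym G'"
  proof (rule symI)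
    fix a b assume "(a, b) \<in> G'"
    then show "(b, a) \<in> G'" using symG[of a b] symG[of q b] symG[of a q] by (simp add: G'_def) argo
  qed
  moreover have "irrefl G'" by (simp add: irrefl_def G'_def)
  ultimately have "borel_graph G'" by (simp add: borel_graph_def)
  moreover have "G' \<subseteq> E"
  proof (rule subrelI)
    fix a b assume "(a, b) \<in> G'"
    then consider "(a, b) \<in> E" | "a = h" "(q, b) \<in> E" | "b = h" "(a, q) \<in> E" | "a = q" "b = t"
      | "a = t" "b = q"
      using G(2) unfolding G'_def by blast
    then show "(a, b) \<in> E"
      by cases (use q(1,2) symE transE in metis)+
  qed
  moreover have "E \<subseteq> (G'\<^sup>=) ^^ Suc n"
  proof -
    \<comment> \<open>Collapsing \<open>q\<close> onto \<open>h\<close> maps edges of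
      \<open>G\<close> to edges of \<open>G'\<close> or to loops, so distances between vertices
      other than \<open>q\<close> stay bounded by \<open>n\<close>.\<close>
    define \<rho> where "\<rho> a = (if a = q then h else a)" for a
    have hom: "(\<rho> a, \<rho> b) \<in> G'\<^sup>=" if "(a, b) \<in> G\<^sup>=" for a b
      using that \<open>q \<noteq> h\<close> by (auto simp: \<rho>_def G'_def)
    have homk: "(\<rho> a, \<rho> b) \<in> (G'\<^sup>=) ^^ k" if "(a, b) \<in> (G\<^sup>=) ^^ k" for a b k
      using that
    proof (induction k arbitrary: b)
      case (Suc k)
      then obtain c where "(a, c) \<in> (G\<^sup>=) ^^ k" "(c, b) \<in> G\<^sup>=" by auto
      then show ?case using Suc.IH hom by (meson relpow_Suc_I)
    qed simp
    have off: "(a, b) \<in> (G'\<^sup>=) ^^ n" if "(a, b) \<in> E" "a \<noteq> q" "b \<noteq> q" for a b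
      using homk[OF subsetD[OF G(3) that(1)]] that(2,3) by (simp add: \<rho>_def)
    have qt: "(q, t) \<in> G'\<^sup>=" "(t, q) \<in> G'\<^sup>=" using \<open>q \<noteq> t\<close> by (auto simp: G'_def)
    have "(a, b) \<in> (G'\<^sup>=) ^^ Suc n" if ab: "(a, b) \<in> E" for a b
    proof -
      consider "a \<noteq> q" "b \<noteq> q" | "a \<noteq> q" "b = q" | "a = q" "b \<noteq> q" | "a = q" "b = q" by blast
      then show ?thesis
      proof cases
        case 1
        then show ?thesis using relpow_Suc_I[OF off[OF ab], of b] by simp
      next
        case 2
        have "(a, t) \<in> E" using ab q(2) 2 transE by blast
        then show ?thesis using relpow_Suc_I[OF off qt(2)] 2 q(4) by simp
      next
        case 3
        have "(t, b) \<in> E" using ab symE[OF q(2)] 3 transE by blast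
        then show ?thesis using relpow_Suc_I2[OF qt(1) off] 3 q(4) by simp
      next
        case 4
        then show ?thesis unfolding relpow_reflcl_iff by (intro exI[of _ 0]) simp
      qed
    qed
    then show ?thesis by auto
  qed
  \<comment> \<open>Rerouted edges inherit the inequality because \<phi> vanishes at both
    \<open>q\<close> and \<open>h\<close>.\<close>
  moreover have "(\<phi>(q := \<phi> t + 1)) a \<le> (\<phi>(q := \<phi> t + 1)) b + 1" if "(a, b) \<in> G'" for a b
    using that \<phi>(1)[of a b] \<phi>(1)[of q b] \<phi>(1)[of a q] \<phi>(2,3) \<open>q \<noteq> t\<close> by (auto simp: G'_def)
  ultimately show ?thesis using that by blast
qed

text \<open>Starting from \<open>G0\<close>, pendant vertices are attached one by one inside a
  single infinite class. As long as no graph with least bound exactly \<open>Suc n\<close> occurs,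
  the bound \<open>n\<close> persists while the tail grows. A tail of length \<open>Suc n\<close>
  contradicts that bound.\<close>

lemma ex_graph_exact_diameter:
  fixes E :: "('x::polish_space \<times> 'x) set"
  assumes E: "equiv UNIV E"
    and G0: "borel_graph G0" "G0 \<subseteq> E" "E \<subseteq> (G0\<^sup>=) ^^ Suc n"
    and inf: "infinite {y. (x, y) \<in> E}"
  shows "\<exists>G. borel_graphable_by E G \<and> graph_diameter G = enat (Suc n)"
proof -
  obtain q :: "nat \<Rightarrow> 'x" where q: "inj q" "range q \<subseteq> {y. (x, y) \<in> E}"
    using inf infinite_countable_subset by blast
  have qE: "(q i, q j) \<in> E" for i j
    using q(2) E by (metis equivE mem_Collect_eq rangeI subsetD symD transD)
  let ?exact = "\<exists>G. borel_graph G \<and> G \<subseteq> E \<and> E \<subseteq> (G\<^sup>=) ^^ Suc n \<and> \<not> E \<subseteq> (G\<^sup>=) ^^ n"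
  \<comment> \<open>The zeros at later \<open>q j\<close> allow the next vertex to be merged into
    \<open>q 0\<close>.\<close>
  let ?tail = "\<lambda>k. \<exists>G \<phi>. borel_graph G \<and> G \<subseteq> E \<and> E \<subseteq> (G\<^sup>=) ^^ n \<and>
      (\<forall>a b. (a, b) \<in> G \<longrightarrow> \<phi> a \<le> \<phi> b + 1) \<and> \<phi> (q 0) = 0 \<and> \<phi> (q k) = k \<and> (\<forall>j>k. \<phi> (q j) = (0::nat))"
  have dichotomy: "?exact \<or> ?tail k" for k
  proof (induction k)
    case 0
    show ?case
    proof (cases "E \<subseteq> (G0\<^sup>=) ^^ n")
      case True
      then have "?tail 0" using G0 by (intro exI[of _ G0] exI[of _ "\<lambda>_. 0"]) auto
      then show ?thesis ..
    qed (use G0 in blast)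
  next
    case (Suc k)
    show ?case
    proof (cases ?exact)
      case False
      then obtain G \<phi> where G: "borel_graph G" "G \<subseteq> E" "E \<subseteq> (G\<^sup>=) ^^ n"
        "\<And>a b. (a, b) \<in> G \<Longrightarrow> \<phi> a \<le> \<phi> b + 1" "\<phi> (q 0) = 0" "\<phi> (q k) = k" "\<And>j. j > k \<Longrightarrow> \<phi> (q j) = (0::nat)"
        using Suc by metis
      have neq: "q i \<noteq> q j" if "i \<noteq> j" for i j using that q(1) by (simp add: inj_eq)
      obtain G' where G': "borel_graph G'" "G' \<subseteq> E" "E \<subseteq> (G'\<^sup>=) ^^ Suc n"
        "\<And>a b. (a, b) \<in> G' \<Longrightarrow>
          (\<phi>(q (Suc k) := \<phi> (q k) + 1)) a \<le> (\<phi>(q (Suc k) := \<phi> (q k) + 1)) b + 1"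
        by (rule attach_pendant_vertex[where \<phi> = \<phi> and q = "q (Suc k)" and h = "q 0" and t = "q k",
            OF E G(1-3)]) (use qE neq G(4,5,7) in \<open>simp_all del: relpow.simps\<close>)
      then have "E \<subseteq> (G'\<^sup>=) ^^ n" using False by blast
      then have "?tail (Suc k)"
        using G' G neq by (intro exI[of _ G'] exI[of _ "\<phi>(q (Suc k) := \<phi> (q k) + 1)"]) auto
      then show ?thesis ..
    qed simp
  qed
  have no_tail: "\<not> ?tail (Suc n)"
  proof
    assume "?tail (Suc n)"
    then obtain G \<phi> where G: "E \<subseteq> (G\<^sup>=) ^^ n" "\<And>a b. (a, b) \<in> G \<Longrightarrow> \<phi> a \<le> \<phi> b + 1"
      "\<phi> (q 0) = 0" "\<phi> (q (Suc n)) = Suc n" by blast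
    have "\<phi> a \<le> \<phi> b + k" if "(a, b) \<in> (G\<^sup>=) ^^ k" for a b k
      using that
    proof (induction k arbitrary: b)
      case (Suc k)
      then obtain c where c: "(a, c) \<in> (G\<^sup>=) ^^ k" "(c, b) \<in> G\<^sup>=" by auto
      then show ?case using Suc.IH[OF c(1)] G(2)[of c b] by auto
    qed simp
    then have "\<phi> (q (Suc n)) \<le> \<phi> (q 0) + n" using qE G(1) by blast
    then show False using G by simp
  qed
  have ?exact using dichotomy[of "Suc n"] by (rule disjE) (assumption, erule notE[OF no_tail])
  then obtain G where G: "borel_graph G" "G \<subseteq> E" "E \<subseteq> (G\<^sup>=) ^^ Suc n" "\<not> E \<subseteq> (G\<^sup>=) ^^ n"
    by blast
  then have "G\<^sup>* = E" using rtrancl_eqI[OF E] by blast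
  then show ?thesis
    using G graph_diameter_eqI[of G n] by (auto simp: borel_graphable_by_def)
qed

section \<open>The graph of an orbit equivalence relation\<close>

lemma equiv_orbit_equivalence:
  assumes "continuous_action act"
  shows "equiv UNIV (orbit_equivalence act)"
proof (rule equivI)
  have 0: "act 0 x = x" and add: "act (g + h) x = act g (act h x)" for g h x
    using assms by (auto simp: continuous_action_def)
  show "refl (orbit_equivalence act)"
    using 0 by (auto simp: refl_on_def orbit_equivalence_def)
  show "sym (orbit_equivalence act)"
  proof (rule symI)
    fix x y assume "(x, y) \<in> orbit_equivalence act"
    then obtain g where "act g x = y" by (auto simp: orbit_equivalence_def)
    then have "act (- g) y = x" using 0 add by (metis left_minus)
    then show "(y, x) \<in> orbit_equivalence act" by (auto simp: orbit_equivalence_def)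
  qed
  show "trans (orbit_equivalence act)"
    by (rule transI) (auto simp: orbit_equivalence_def simp flip: add)
qed simp

text \<open>If no \<open>D i\<close> in \<open>V\<close> moves \<open>x\<close>, then by density no
  element of the open set \<open>V\<close> does. Each translate \<open>g + V\<close> contains some
  \<open>D i\<close>, which sends \<open>x\<close> to the same point as \<open>g\<close>, so the
  orbit is countable.\<close>

lemma ex_moving_action:
  fixes act :: "'g::{polish_space, topological_group_add} \<Rightarrow> 'x::polish_space \<Rightarrow> 'x"
  assumes act: "continuous_action act"
    and unc: "\<And>x. uncountable {y. (x, y) \<in> orbit_equivalence act}"
  obtains D where "moving_action act D"
proof -
  have act0: "act 0 x = x" and add: "act (g + h) x = act g (act h x)" for g h x
    using act by (auto simp: continuous_action_def)
  have cont: "continuous_on UNIV (\<lambda>g. act g x)" for x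
  proof -
    have "continuous_on UNIV (\<lambda>p. act (fst p) (snd p))"
      using act by (simp add: continuous_action_def case_prod_beta)
    then show ?thesis
      by (rule continuous_on_compose2[where f = "\<lambda>g. (g, x)" and g = "\<lambda>p. act (fst p) (snd p)", simplified])
         (auto intro!: continuous_intros)
  qed
  obtain D :: "nat \<Rightarrow> 'g" where D: "\<And>V. open V \<Longrightarrow> V \<noteq> {} \<Longrightarrow> \<exists>i. D i \<in> V"
    using dense_sequence by blast
  have "\<exists>i. D i \<in> V \<and> act (D i) x \<noteq> x" if V: "open V" "0 \<in> V" for V x
  proof (rule ccontr)
    assume no: "\<not> ?thesis"
    have "open ((\<lambda>g. act g x) -` (- {x}))" by (intro open_vimage cont) auto
    then have "open (V \<inter> (\<lambda>g. act g x) -` (- {x}))" using V(1) by blast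
    then have "V \<inter> (\<lambda>g. act g x) -` (- {x}) = {}" using D no by blast
    then have stab: "act g x = x" if "g \<in> V" for g using that by blast
    have "act g x \<in> range (\<lambda>i. act (D i) x)" for g
    proof -
      have "open ((\<lambda>k. - g + k) -` V)" by (intro open_vimage V continuous_intros)
      moreover have "g \<in> (\<lambda>k. - g + k) -` V" using V(2) by simp
      ultimately obtain i where "- g + D i \<in> V" using D by blast
      then have "act g (act (- g + D i) x) = act g x" using stab by simp
      then have "act (D i) x = act g x" by (simp flip: add add.assoc)
      then show ?thesis by (metis rangeI)
    qed
    then have "{y. (x, y) \<in> orbit_equivalence act} \<subseteq> range (\<lambda>i. act (D i) x)"
      by (auto simp: orbit_equivalence_def)
    then show False using unc by (meson countable_subset countable_image countableI_type)
  qed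
  then have "moving_action act D" by unfold_locales (auto simp: act)
  then show ?thesis by (rule that)
qed

section \<open>Construction of a Borel graph of diameter at most 4\<close>

context moving_action
begin

lemma ex_graph_diameter_le_4:
  assumes \<psi> [measurable]: "\<And>i :: nat. \<psi> i \<in> borel_measurable borel"
    and dec: "\<And>x y. \<exists>v i j. (x, v) \<in> orbit_equivalence act \<and> \<psi> i v = x \<and> \<psi> j v = y"
  shows "\<exists>G. borel_graph G \<and> G \<subseteq> orbit_equivalence act \<and> orbit_equivalence act \<subseteq> (G\<^sup>=) ^^ 4"
proof -
  let ?E = "orbit_equivalence act"
  have symE: "(x, y) \<in> ?E \<Longrightarrow> (y, x) \<in> ?E" and transE: "(x, y) \<in> ?E \<Longrightarrow> (y, z) \<in> ?E \<Longrightarrow> (x, z) \<in> ?E" for x y z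
    using equiv_orbit_equivalence[OF action] by (meson equivE symD transD)+
  obtain \<kappa> :: "(nat \<Rightarrow> bool) \<Rightarrow> 'g" where "surj \<kappa>" and \<kappa> [measurable (raw)]:
    "\<And>(M :: ('x \<times> 'x) measure) b. (\<And>n. Measurable.pred M (\<lambda>x. b x n)) \<Longrightarrow> (\<lambda>x. \<kappa> (b x)) \<in> borel_measurable M"
    using polish_decoding by blast
  \<comment> \<open>Decoding and encoding again tests whether \<open>u\<close> is a coding point of
    \<open>x\<close>. This replaces a quantifier over all sequences and makes the condition
    Borel.\<close>
  define coded where "coded x u \<longleftrightarrow> coding_point x (decode x u) = u" for x u
  \<comment> \<open>The quantifier over indices \<open>i\<close> is countable, so \<open>R\<close>
    is Borel.\<close>
  define R where "R = {(x, u). coded x u \<or>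
    (\<exists>i. coded (\<psi> i u) x \<and> act (\<kappa> (decode (\<psi> i u) x)) (\<psi> i u) = u)}"
  define G where "G = (R \<union> R\<inverse>) - Id"
  have coded: "(x, u) \<in> ?E" if "coded x u" for x u
    using that unfolding coded_def coding_point_def orbit_equivalence_def by blast
  have "R \<subseteq> ?E"
  proof (rule subrelI)
    fix x u assume "(x, u) \<in> R"
    then consider "coded x u" | i where "coded (\<psi> i u) x" "act (\<kappa> (decode (\<psi> i u) x)) (\<psi> i u) = u"
      unfolding R_def by blast
    then show "(x, u) \<in> ?E"
    proof cases
      case 2
      \<comment> \<open>A decoded point may lie in any orbit; the equation for the action forces it
        into the orbit of \<open>u\<close>.\<close>
      then have "(\<psi> i u, u) \<in> ?E" unfolding orbit_equivalence_def by blast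
      then show ?thesis using coded[OF 2(1)] symE transE by blast
    qed (rule coded)
  qed
  then have "G \<subseteq> ?E" using symE unfolding G_def by blast
  moreover have "borel_graph G"
  proof -
    have coded_eq: "coded x u \<longleftrightarrow> dist (coding_point x (decode x u)) u = 0" for x u
      by (simp add: coded_def)
    have "R = {p \<in> space borel. coded (fst p) (snd p) \<or> (\<exists>i. coded (\<psi> i (snd p)) (fst p) \<and>
        dist (act (\<kappa> (decode (\<psi> i (snd p)) (fst p))) (\<psi> i (snd p))) (snd p) = 0)}"
      by (simp add: R_def set_eq_iff)
    also have "\<dots> \<in> sets borel" unfolding coded_eq by measurable
    finally have [measurable]: "R \<in> sets borel" .
    have "G = {p \<in> space borel. ((fst p, snd p) \<in> R \<or> (snd p, fst p) \<in> R) \<and> dist (fst p) (snd p) \<noteq> 0}"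
      by (auto simp: G_def)
    also have "\<dots> \<in> sets borel" by measurable
    finally show ?thesis by (auto simp: borel_graph_def G_def irrefl_def sym_def)
  qed
  moreover have "?E \<subseteq> (G\<^sup>=) ^^ 4"
  proof (rule subrelI)
    fix x y assume xy: "(x, y) \<in> ?E"
    obtain v i j where v: "(x, v) \<in> ?E" "\<psi> i v = x" "\<psi> j v = y" using dec by blast
    \<comment> \<open>Two edges connect \<open>v\<close> with any point of its orbit decoded from
      it; using this for \<open>x\<close> and for \<open>y\<close> gives four.\<close>
    have mid: "\<exists>u. (z, u) \<in> G\<^sup>= \<and> (u, v) \<in> G\<^sup>= \<and> (v, u) \<in> G\<^sup>= \<and> (u, z) \<in> G\<^sup>="
      if z: "(z, v) \<in> ?E" "\<psi> k v = z" for z k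
    proof -
      obtain g where g: "act g z = v" using z(1) by (auto simp: orbit_equivalence_def)
      obtain a where a: "\<kappa> a = g" using \<open>surj \<kappa>\<close> by (metis surjD)
      define u where "u = coding_point z a"
      have "decode z u = a" unfolding u_def by (rule decode_coding_point)
      then have "coded z u" "act (\<kappa> (decode (\<psi> k v) u)) (\<psi> k v) = v"
        using z(2) a g by (simp_all add: coded_def u_def)
      then have "(z, u) \<in> R" "(u, v) \<in> R" using z(2) unfolding R_def by blast+
      then show ?thesis unfolding G_def by blast
    qed
    have "(y, v) \<in> ?E" using xy v(1) symE transE by blast
    then obtain u u' where "(x, u) \<in> G\<^sup>=" "(u, v) \<in> G\<^sup>=" "(v, u') \<in> G\<^sup>=" "(u', y) \<in> G\<^sup>="
      using mid[OF v(1,2)] mid[OF _ v(3)] by blast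
    then have "(x, y) \<in> (G\<^sup>=) ^^ Suc (Suc (Suc (Suc 0)))"
      by (meson relpow_0_I relpow_Suc_I)
    then show "(x, y) \<in> (G\<^sup>=) ^^ 4" by (simp only: numeral_eq_Suc pred_numeral_simps BitM.simps One_nat_def)
  qed
  ultimately show ?thesis by blast
qed

end

theorem theorem4p8:
  fixes act :: "'g::{polish_space, topological_group_add} \<Rightarrow> 'x::polish_space \<Rightarrow> 'x"
  assumes "continuous_action act"
    and "borel_coding_property (orbit_equivalence act)"
  shows "\<exists>G. borel_graphable_by (orbit_equivalence act) G \<and> graph_diameter G = 4"
proof -
  have unc: "uncountable {y. (x, y) \<in> orbit_equivalence act}" for x
    using assms(2) by (rule uncountable_class)
  obtain D where "moving_action act D" using ex_moving_action[OF assms(1) unc] .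
  then interpret moving_action act D .
  obtain \<psi> :: "nat \<Rightarrow> 'x \<Rightarrow> 'x" where \<psi>: "\<And>i. \<psi> i \<in> borel_measurable borel"
    "\<And>x y. \<exists>v i j. (x, v) \<in> orbit_equivalence act \<and> \<psi> i v = x \<and> \<psi> j v = y"
    using coding_maps[OF assms(2)] by blast
  obtain G where "borel_graph G" "G \<subseteq> orbit_equivalence act" "orbit_equivalence act \<subseteq> (G\<^sup>=) ^^ 4"
    using ex_graph_diameter_le_4[OF \<psi>] by blast
  \<comment> \<open>One infinite orbit suffices for growing the tail, and that of
    \<open>undefined\<close> is taken.\<close>
  then have "\<exists>G. borel_graphable_by (orbit_equivalence act) G \<and> graph_diameter G = enat (Suc 3)"
    using unc[of undefined]
    by (intro ex_graph_exact_diameter[OF equiv_orbit_equivalence[OF assms(1)]])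
       (auto dest: countable_finite)
  then show ?thesis by (simp add: numeral_eq_enat)
qed

end
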